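(* Let $X$ be a compact metric space that is not a single point, and let $f:X\to X$ be a continuous map that is chain mixing. Let $d$ be the lower box dimension of $X$. Then the topological entropy $h(f)$ satisfies $$h(f)\ \ge\ d\cdot \limsup_{\delta\to0}\frac{\log (1/\delta)}{\lim_{\varepsilon\to0}m_\varepsilon(\delta,f)}.$$
   Context: Write $\mathrm{dist}$ for the metric of $X$. An $\varepsilon$-chain (for $f$) of length $n\ge 1$ from $x$ to $y$ is a sequence $(x=x_0,x_1,\dots,x_n=y)$ with $\mathrm{dist}(f(x_{i-1}),x_i)\le\varepsilon$ for $i=1,\dots,n$. The map $f$ is $\varepsilon$-chain mixing if there is $N>0$ such that for any $x,y\in X$ and any $n\ge N$ there is an $\varepsilon$-chain from $x$ to $y$ of length exactly $n$; $f$ is chain mixing if it is $\varepsilon$-chain mixing for every $\varepsilon>0$. For $0<\varepsilon<\delta$ and $x\in X$, the chain mixing time $m_\varepsilon(x,\delta,f)$ is the smallest positive integer $N$ such that for any $n\ge N$ and any $y\in X$ there is an $\varepsilon$-chain of length exactly $n$ from some point of $B_\delta(x)$ to $y$, where $B_\delta(x)=\{z\in X:\mathrm{dist}(x,z)\le\delta\}$. Set $m_\varepsilon(\delta,f)=\max_{x\in X}m_\varepsilon(x,\delta,f)$. For fixed $\delta$ this is nondecreasing as $\varepsilon$ decreases, so $\lim_{\varepsilon\to0}m_\varepsilon(\delta,f)$ exists in $[1,\infty]$; the quotient is read as $0$ when this limit is $\infty$. The lower box dimension of $X$ is $\liminf_{\alpha\to0}\frac{\log N_{\mathrm{span}}(\alpha)}{\log(1/\alpha)}$,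 where $N_{\mathrm{span}}(\alpha)$ is the minimum number of balls of radius $\alpha$ needed to cover $X$. *)

theory Defs
  imports "HOL-Analysis.Analysis"
begin

text \<open>
  Throughout, the compact metric space is a compact set \<open>X\<close> in a metric space and
  \<open>f\<close> is a map whose values matter only on \<open>X\<close>. Chains, ball centres and separated sets are
  all confined to \<open>X\<close>.
\<close>

definition eps_chain ::
  "'a::metric_space set \<Rightarrow> ('a \<Rightarrow> 'a) \<Rightarrow> real \<Rightarrow> nat \<Rightarrow> (nat \<Rightarrow> 'a) \<Rightarrow> 'a \<Rightarrow> 'a \<Rightarrow> bool" where
  "eps_chain X f \<epsilon> n p x y \<longleftrightarrow>
     n \<ge> 1 \<and> (\<forall>i\<le>n. p i \<in> X) \<and> p 0 = x \<and> p n = y \<and>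
     (\<forall>i\<in>{1..n}. dist (f (p (i - 1))) (p i) \<le> \<epsilon>)"

definition eps_chain_mixing :: "'a::metric_space set \<Rightarrow> ('a \<Rightarrow> 'a) \<Rightarrow> real \<Rightarrow> bool" where
  "eps_chain_mixing X f \<epsilon> \<longleftrightarrow>
     (\<exists>N>0. \<forall>x\<in>X. \<forall>y\<in>X. \<forall>n\<ge>N. \<exists>p. eps_chain X f \<epsilon> n p x y)"

definition chain_mixing :: "'a::metric_space set \<Rightarrow> ('a \<Rightarrow> 'a) \<Rightarrow> bool" where
  "chain_mixing X f \<longleftrightarrow> (\<forall>\<epsilon>>0. eps_chain_mixing X f \<epsilon>)"

text \<open>
  If \<open>f\<close> is chain mixing and \<open>\<epsilon> > 0\<close>, the least element below exists and is bounded
  uniformly in \<open>x\<close>; hence the set whose maximum is taken afterwards is finite.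
\<close>

definition mixing_time_at ::
  "'a::metric_space set \<Rightarrow> ('a \<Rightarrow> 'a) \<Rightarrow> real \<Rightarrow> real \<Rightarrow> 'a \<Rightarrow> nat" where
  "mixing_time_at X f \<epsilon> \<delta> x =
     (LEAST N. N > 0 \<and>
        (\<forall>n\<ge>N. \<forall>y\<in>X. \<exists>z \<in> X \<inter> cball x \<delta>. \<exists>p. eps_chain X f \<epsilon> n p z y))"

definition mixing_time ::
  "'a::metric_space set \<Rightarrow> ('a \<Rightarrow> 'a) \<Rightarrow> real \<Rightarrow> real \<Rightarrow> nat" where
  "mixing_time X f \<epsilon> \<delta> = Max (mixing_time_at X f \<epsilon> \<delta> ` X)"

text \<open>
  For chain mixing \<open>f\<close> the mixing time is nondecreasing as \<open>\<epsilon>\<close> decreases, so the limit exists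
  in \<open>ereal\<close> and lies in \<open>[1, \<infinity>]\<close>; a real divided by \<open>\<infinity>\<close> is \<open>0\<close> in \<open>ereal\<close>.
\<close>

definition limit_mixing_time ::
  "'a::metric_space set \<Rightarrow> ('a \<Rightarrow> 'a) \<Rightarrow> real \<Rightarrow> ereal" where
  "limit_mixing_time X f \<delta> =
     Lim (at_right 0) (\<lambda>\<epsilon>. ereal (real (mixing_time X f \<epsilon> \<delta>)))"

definition covering_number :: "'a::metric_space set \<Rightarrow> real \<Rightarrow> nat" where
  "covering_number X \<alpha> =
     (LEAST k. \<exists>C. C \<subseteq> X \<and> finite C \<and> card C = k \<and> X \<subseteq> (\<Union>c\<in>C. cball c \<alpha>))"

definition lower_box_dim :: "'a::metric_space set \<Rightarrow> ereal" where
  "lower_box_dim X =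
     Liminf (at_right 0) (\<lambda>\<alpha>. ereal (ln (real (covering_number X \<alpha>)) / ln (1 / \<alpha>)))"

text \<open>
  Topological entropy in Bowen's form: \<open>separated_number X f n \<epsilon>\<close> is the largest cardinality of
  an \<open>(n, \<epsilon>)\<close>-separated subset of \<open>X\<close>, which is attained when \<open>X\<close> is compact, \<open>f\<close> is a
  continuous self-map of \<open>X\<close> and \<open>\<epsilon> > 0\<close>. Entropy takes values in \<open>[0, \<infinity>]\<close>; the limit in \<open>\<epsilon>\<close>
  exists by monotonicity.
\<close>

definition separated ::
  "'a::metric_space set \<Rightarrow> ('a \<Rightarrow> 'a) \<Rightarrow> nat \<Rightarrow> real \<Rightarrow> 'a set \<Rightarrow> bool" where
  "separated X f n \<epsilon> E \<longleftrightarrow> E \<subseteq> X \<and>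
     (\<forall>x\<in>E. \<forall>y\<in>E. x \<noteq> y \<longrightarrow> (\<exists>i<n. dist ((f ^^ i) x) ((f ^^ i) y) > \<epsilon>))"

definition separated_number ::
  "'a::metric_space set \<Rightarrow> ('a \<Rightarrow> 'a) \<Rightarrow> nat \<Rightarrow> real \<Rightarrow> nat" where
  "separated_number X f n \<epsilon> = Max (card ` {E. finite E \<and> separated X f n \<epsilon> E})"

definition topological_entropy :: "'a::metric_space set \<Rightarrow> ('a \<Rightarrow> 'a) \<Rightarrow> ereal" where
  "topological_entropy X f =
     Lim (at_right 0)
       (\<lambda>\<epsilon>. limsup (\<lambda>n. ereal (ln (real (separated_number X f n \<epsilon>)) / real n)))"

end

theory Submission
  imports Defs
begin

text \<open>
  The idea is that a finite limiting mixing time forces a full shift. Fix \<open>\<delta>\<close> and suppose that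
  \<open>m = lim_{\<epsilon>\<rightarrow>0} m_\<epsilon>(\<delta>, f)\<close> is finite. The times \<open>m_\<epsilon>(\<delta>, f)\<close> are integers, all at most
  \<open>N = \<lfloor>m\<rfloor>\<close>, so for every \<open>\<epsilon> > 0\<close> each point of \<open>X\<close> is the end of an \<open>\<epsilon>\<close>-chain of the same
  length \<open>N\<close> that starts in a given \<open>\<delta>\<close>-ball. An \<open>\<epsilon>\<close>-chain of fixed length shadows a true orbit up
  to an error that vanishes with \<open>\<epsilon>\<close>, so by compactness \<open>f\<^sup>N\<close> maps every \<open>\<delta>\<close>-ball \<^emph>\<open>onto\<close> \<open>X\<close>
  (\<open>limit_mixing_time_finite_imp_ball_onto\<close>).

  Now let \<open>E\<close> be a set whose points are pairwise more than \<open>3\<delta>\<close> apart. Pulling an \<open>(n, \<delta>)\<close>-separated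
  set back by \<open>f\<^sup>N\<close> into each of the \<open>\<delta>\<close>-balls around the points of \<open>E\<close> gives \<open>card E\<close> copies of it,
  which together are \<open>(N + n, \<delta>)\<close>-separated: points in different copies are apart at time \<open>0\<close>,
  points in the same copy are apart after time \<open>N\<close>. Hence the separated numbers at scale \<open>\<delta>\<close> grow
  at least like \<open>(card E)\<^bsup>n/N\<^esup>\<close> (\<open>separated_number_mult_le\<close>). A largest such \<open>E\<close> covers \<open>X\<close> by its
  \<open>3\<delta>\<close>-balls, so \<open>card E\<close> is at least the covering number of \<open>X\<close> at scale \<open>3\<delta>\<close>, and therefore
  \<open>h(f) \<ge> log (covering number at 3\<delta>) / m\<close> (\<open>entropy_ge_covering_number_over_mixing_time\<close>).

  For every \<open>a\<close> below the lower box dimension, the numerator is at least \<open>a log (1/\<delta>)\<close> as soon as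
  \<open>\<delta>\<close> is small, the factor \<open>3\<close> being swallowed by a slightly larger exponent. So
  \<open>h(f) \<ge> a log (1/\<delta>) / m\<close> for all small \<open>\<delta>\<close>; the case \<open>m = \<infinity>\<close> is trivial because \<open>h(f) \<ge> 0\<close>.
\<close>

section \<open>Limits at zero of monotone functions\<close>

text \<open>
  Both the mixing time and the entropy at scale \<open>\<epsilon>\<close> grow as \<open>\<epsilon>\<close> decreases, so both limits in the
  statement are suprema; below, every use of these limits is an inequality with a single term.
\<close>

lemma Lim_at_right_0_eq_SUP:
  fixes g :: "real \<Rightarrow> ereal"
  assumes mono: "\<And>s t. 0 < s \<Longrightarrow> s \<le> t \<Longrightarrow> g t \<le> g s"
  shows "Lim (at_right 0) g = (SUP t\<in>{0<..}. g t)"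
proof (rule tendsto_Lim)
  show "(g \<longlongrightarrow> (SUP t\<in>{0<..}. g t)) (at_right 0)"
  proof (rule order_tendstoI)
    fix a assume "a < (SUP t\<in>{0<..}. g t)"
    then obtain t where t: "t > 0" "a < g t" by (auto simp: less_SUP_iff)
    have "\<forall>\<^sub>F s in at_right 0. s < t \<and> 0 < s"
      using t(1) eventually_at_right_field by blast
    then show "\<forall>\<^sub>F s in at_right 0. a < g s"
      by eventually_elim (meson mono t(2) less_imp_le order.strict_trans2)
  next
    fix a assume a: "(SUP t\<in>{0<..}. g t) < a"
    have "\<forall>\<^sub>F s in at_right (0::real). 0 < s" by (simp add: eventually_at_right_less)
    then show "\<forall>\<^sub>F s in at_right 0. g s < a"
      by eventually_elim (meson a SUP_upper greaterThan_iff order.strict_trans1)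
  qed
qed simp

section \<open>Separated sets and entropy\<close>

lemma funpow_in_space:
  assumes "f \<in> X \<rightarrow> X" "x \<in> X"
  shows "(f ^^ n) x \<in> X"
  using assms by (induction n) auto

lemma continuous_on_funpow:
  assumes "continuous_on X f" "f \<in> X \<rightarrow> X"
  shows "continuous_on X (f ^^ n)"
proof (induction n)
  case (Suc n)
  have "(f ^^ n) ` X \<subseteq> X" using funpow_in_space[OF assms(2)] by blast
  then have "continuous_on X (f \<circ> (f ^^ n))"
    using assms(1) by (intro continuous_on_compose[OF Suc]) (rule continuous_on_subset)
  then show ?case by simp
qed (simp add: id_def)

lemma compact_finite_ball_cover:
  fixes X :: "'a::metric_space set"
  assumes "compact X" "r > 0"
  obtains C where "C \<subseteq> X" "finite C" "X \<subseteq> (\<Union>c\<in>C. ball c r)"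
proof (rule compactE_image[OF assms(1), of X "\<lambda>c. ball c r"])
  show "X \<subseteq> (\<Union>c\<in>X. ball c r)" using assms(2) by auto
qed (use that in auto)

lemma separatedD:
  assumes "separated X f n \<epsilon> E" "x \<in> E" "y \<in> E" "x \<noteq> y"
  shows "\<exists>i<n. dist ((f ^^ i) x) ((f ^^ i) y) > \<epsilon>"
  using assms by (simp add: separated_def)

lemma separated_weaken:
  assumes "separated X f m \<epsilon>' E" "m \<le> n" "\<epsilon> \<le> \<epsilon>'"
  shows "separated X f n \<epsilon> E"
  unfolding separated_def
proof (intro conjI ballI impI)
  show "E \<subseteq> X" using assms(1) by (simp add: separated_def)
  fix x y assume "x \<in> E" "y \<in> E" "x \<noteq> y"
  then obtain i where "i < m" "dist ((f ^^ i) x) ((f ^^ i) y) > \<epsilon>'"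
    using separatedD[OF assms(1)] by blast
  then show "\<exists>i<n. dist ((f ^^ i) x) ((f ^^ i) y) > \<epsilon>"
    using assms(2,3) by (intro exI[of _ i]) simp
qed

text \<open>
  The iterates up to time \<open>n\<close> are uniformly equicontinuous, so a finite cover by small enough balls
  bounds every separated set. This makes the maximum that defines the separated number a maximum
  over a finite set.
\<close>

lemma separated_imp_card_bounded:
  assumes "compact X" "continuous_on X f" "f \<in> X \<rightarrow> X" "\<epsilon> > 0"
  obtains B where "\<And>E. separated X f n \<epsilon> E \<Longrightarrow> card E \<le> B"
proof -
  have "\<exists>d>0. \<forall>x\<in>X. \<forall>y\<in>X. dist x y < d \<longrightarrow> (\<forall>i<n. dist ((f ^^ i) x) ((f ^^ i) y) < \<epsilon>)"
  proof (induction n)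
    case 0
    then show ?case by (auto intro: exI[of _ 1])
  next
    case (Suc n)
    then obtain d where d: "d > 0"
      "\<forall>x\<in>X. \<forall>y\<in>X. dist x y < d \<longrightarrow> (\<forall>i<n. dist ((f ^^ i) x) ((f ^^ i) y) < \<epsilon>)"
      by blast
    have "uniformly_continuous_on X (f ^^ n)"
      using assms(1) continuous_on_funpow[OF assms(2,3)] compact_uniformly_continuous by blast
    then obtain d' where d': "d' > 0"
      "\<forall>x\<in>X. \<forall>y\<in>X. dist x y < d' \<longrightarrow> dist ((f ^^ n) x) ((f ^^ n) y) < \<epsilon>"
      using assms(4) unfolding uniformly_continuous_on_def by (metis dist_commute)
    have "\<forall>x\<in>X. \<forall>y\<in>X. dist x y < min d d' \<longrightarrow>
        (\<forall>i<Suc n. dist ((f ^^ i) x) ((f ^^ i) y) < \<epsilon>)"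
      using d(2) d'(2) by (auto simp: less_Suc_eq)
    then show ?case using d(1) d'(1) by (intro exI[of _ "min d d'"]) simp
  qed
  then obtain d where d: "d > 0"
    "\<And>x y i. x \<in> X \<Longrightarrow> y \<in> X \<Longrightarrow> dist x y < d \<Longrightarrow> i < n \<Longrightarrow> dist ((f ^^ i) x) ((f ^^ i) y) < \<epsilon>"
    by blast
  obtain C where C: "finite C" "X \<subseteq> (\<Union>c\<in>C. ball c (d / 2))"
    by (rule compact_finite_ball_cover[OF assms(1), of "d / 2"]) (use d(1) in auto)
  show ?thesis
  proof (rule that)
    fix E assume E: "separated X f n \<epsilon> E"
    \<comment> \<open>Two points of \<open>E\<close> in one small ball would stay close for \<open>n\<close> steps.\<close>
    have EX: "E \<subseteq> X" using E by (simp add: separated_def)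
    then have "\<forall>x\<in>E. \<exists>c\<in>C. x \<in> ball c (d / 2)" using C(2) by blast
    then obtain c where c: "\<And>x. x \<in> E \<Longrightarrow> c x \<in> C \<and> x \<in> ball (c x) (d / 2)" by metis
    have "inj_on c E"
    proof (rule inj_onI, rule ccontr)
      fix x y assume xy: "x \<in> E" "y \<in> E" "c x = c y" "x \<noteq> y"
      have "dist x y < d"
        using c[OF xy(1)] c[OF xy(2)] xy(3) dist_triangle_half_r[of "c x" x d y] by simp
      then have "dist ((f ^^ i) x) ((f ^^ i) y) < \<epsilon>" if "i < n" for i
        using d(2) EX xy(1,2) that by blast
      moreover obtain i where "i < n" "dist ((f ^^ i) x) ((f ^^ i) y) > \<epsilon>"
        using separatedD[OF E xy(1,2,4)] by blast
      ultimately show False by (meson order.asym)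
    qed
    then show "card E \<le> card C"
      by (rule card_inj_on_le) (use c C(1) in auto)
  qed
qed

context
  fixes X :: "'a::metric_space set" and f :: "'a \<Rightarrow> 'a"
  assumes compact: "compact X" and cont: "continuous_on X f" and self_map: "f \<in> X \<rightarrow> X"
begin

lemma finite_separated_cards:
  assumes "\<epsilon> > 0"
  shows "finite (card ` {E. finite E \<and> separated X f n \<epsilon> E})"
proof -
  obtain B where "\<And>E. separated X f n \<epsilon> E \<Longrightarrow> card E \<le> B"
    using separated_imp_card_bounded[OF compact cont self_map assms] by blast
  then have "card ` {E. finite E \<and> separated X f n \<epsilon> E} \<subseteq> {..B}" by auto
  then show ?thesis using finite_subset by blast
qed

lemma card_le_separated_number:
  assumes "\<epsilon> > 0" "finite E" "separated X f n \<epsilon> E"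
  shows "card E \<le> separated_number X f n \<epsilon>"
  unfolding separated_number_def
  by (rule Max_ge) (use finite_separated_cards assms in auto)

lemma separated_number_attained:
  assumes "\<epsilon> > 0"
  obtains E where "finite E" "separated X f n \<epsilon> E" "card E = separated_number X f n \<epsilon>"
proof -
  have "{} \<in> {E. finite E \<and> separated X f n \<epsilon> E}" by (simp add: separated_def)
  then have "card ` {E. finite E \<and> separated X f n \<epsilon> E} \<noteq> {}" by blast
  from Max_in[OF finite_separated_cards[OF assms] this] show ?thesis
    using that unfolding separated_number_def by auto
qed

lemma separated_number_pos:
  assumes "\<epsilon> > 0" "X \<noteq> {}"
  shows "separated_number X f n \<epsilon> \<ge> 1"
proof -
  obtain x where "x \<in> X" using assms(2) by blast
  then have "separated X f n \<epsilon> {x}" by (simp add: separated_def)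
  from card_le_separated_number[OF assms(1) _ this] show ?thesis by simp
qed

lemma separated_number_antimono:
  assumes "0 < \<epsilon>" "\<epsilon> \<le> \<epsilon>'"
  shows "separated_number X f n \<epsilon>' \<le> separated_number X f n \<epsilon>"
proof -
  obtain E where E: "finite E" "separated X f n \<epsilon>' E" "card E = separated_number X f n \<epsilon>'"
    by (rule separated_number_attained[of \<epsilon>' n]) (use assms in auto)
  have "separated X f n \<epsilon> E" by (rule separated_weaken[OF E(2)]) (use assms in auto)
  then show ?thesis using card_le_separated_number[OF assms(1) E(1)] E(3) by metis
qed

lemma entropy_at_scale_le_topological_entropy:
  assumes "X \<noteq> {}" "\<epsilon> > 0"
  shows "limsup (\<lambda>n. ereal (ln (real (separated_number X f n \<epsilon>)) / real n)) \<le> topological_entropy X f"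
proof -
  let ?h = "\<lambda>\<epsilon>. limsup (\<lambda>n. ereal (ln (real (separated_number X f n \<epsilon>)) / real n))"
  have "?h t \<le> ?h s" if "0 < s" "s \<le> t" for s t
  proof (intro Limsup_mono always_eventually allI)
    fix n
    have "1 \<le> separated_number X f n t" "separated_number X f n t \<le> separated_number X f n s"
      using separated_number_pos[of t] separated_number_antimono[of s t] that assms(1) by auto
    then show "ereal (ln (real (separated_number X f n t)) / real n)
        \<le> ereal (ln (real (separated_number X f n s)) / real n)"
      by (auto intro!: divide_right_mono)
  qed
  then have "topological_entropy X f = (SUP \<epsilon>\<in>{0<..}. ?h \<epsilon>)"
    unfolding topological_entropy_def by (rule Lim_at_right_0_eq_SUP)
  then show ?thesis using assms(2) by (auto intro: SUP_upper)
qed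

text \<open>
  A set that is \<open>(1, \<alpha>)\<close>-separated and as large as possible cannot be enlarged, so each point of
  \<open>X\<close> is within \<open>\<alpha>\<close> of it.
\<close>

lemma covering_number_le_separated_number:
  assumes "\<alpha> > 0"
  shows "covering_number X \<alpha> \<le> separated_number X f 1 \<alpha>"
proof -
  obtain E where E: "finite E" "separated X f 1 \<alpha> E" "card E = separated_number X f 1 \<alpha>"
    by (rule separated_number_attained[OF assms])
  have "X \<subseteq> (\<Union>c\<in>E. cball c \<alpha>)"
  proof (rule ccontr)
    assume "\<not> ?thesis"
    then obtain x where x: "x \<in> X" "\<And>c. c \<in> E \<Longrightarrow> dist c x > \<alpha>" by fastforce
    then have "x \<notin> E" using assms by fastforce
    have "separated X f 1 \<alpha> (insert x E)"
      using E(2) x unfolding separated_def by (auto simp: dist_commute)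
    from card_le_separated_number[OF assms _ this] show False
      using E(1,3) \<open>x \<notin> E\<close> by simp
  qed
  moreover have "E \<subseteq> X" using E(2) by (simp add: separated_def)
  ultimately show ?thesis
    unfolding covering_number_def using E(1,3) by (intro Least_le) auto
qed

section \<open>Maps that spread small balls over the whole space\<close>

text \<open>
  Separation by \<open>3\<delta>\<close> is what keeps distinct \<open>\<delta>\<close>-balls more than \<open>\<delta>\<close> apart, so that preimages
  chosen in different balls are already distinguished at time \<open>0\<close>; \<open>N \<ge> 1\<close> makes time \<open>0\<close> one of
  the observed times even for \<open>n = 0\<close>.
\<close>

lemma separated_number_mult_le:
  assumes "\<delta> > 0" "N \<ge> 1" and onto: "\<And>x. x \<in> X \<Longrightarrow> X \<subseteq> (f ^^ N) ` (X \<inter> cball x \<delta>)"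
  shows "separated_number X f 1 (3 * \<delta>) * separated_number X f n \<delta> \<le> separated_number X f (N + n) \<delta>"
proof -
  obtain E where E: "finite E" "separated X f 1 (3 * \<delta>) E" "card E = separated_number X f 1 (3 * \<delta>)"
    by (rule separated_number_attained[of "3 * \<delta>" 1]) (use assms(1) in auto)
  obtain F where F: "finite F" "separated X f n \<delta> F" "card F = separated_number X f n \<delta>"
    by (rule separated_number_attained[OF assms(1)])
  have "\<forall>e\<in>E. \<forall>w\<in>F. \<exists>z. z \<in> X \<inter> cball e \<delta> \<and> (f ^^ N) z = w"
  proof (intro ballI)
    fix e w assume "e \<in> E" "w \<in> F"
    then have "e \<in> X" "w \<in> X" using E(2) F(2) by (auto simp: separated_def)
    then have "w \<in> (f ^^ N) ` (X \<inter> cball e \<delta>)" using onto by blast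
    then show "\<exists>z. z \<in> X \<inter> cball e \<delta> \<and> (f ^^ N) z = w" by blast
  qed
  then obtain g where g: "\<And>e w. e \<in> E \<Longrightarrow> w \<in> F \<Longrightarrow> g e w \<in> X \<inter> cball e \<delta> \<and> (f ^^ N) (g e w) = w"
    by metis
  have apart: "\<exists>i<N + n. dist ((f ^^ i) (g e w)) ((f ^^ i) (g e' w')) > \<delta>"
    if *: "e \<in> E" "e' \<in> E" "w \<in> F" "w' \<in> F" "(e, w) \<noteq> (e', w')" for e e' w w'
  proof (cases "e = e'")
    case True
    then obtain i where i: "i < n" "dist ((f ^^ i) w) ((f ^^ i) w') > \<delta>"
      using * separatedD[OF F(2), of w w'] by blast
    have "(f ^^ (i + N)) (g e w) = (f ^^ i) w" "(f ^^ (i + N)) (g e' w') = (f ^^ i) w'"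
      using g * by (simp_all add: funpow_add)
    then show ?thesis using i by (intro exI[of _ "i + N"]) simp
  next
    case False
    then have "dist e e' > 3 * \<delta>" using * separatedD[OF E(2), of e e'] by auto
    moreover have "dist e (g e w) \<le> \<delta>" "dist e' (g e' w') \<le> \<delta>" using g * by auto
    ultimately have "dist (g e w) (g e' w') > \<delta>"
      using dist_triangle[of e e' "g e w"] dist_triangle[of "g e w" e' "g e' w'"]
      by (simp add: dist_commute)
    then show ?thesis using assms(2) by (intro exI[of _ 0]) simp
  qed
  let ?G = "\<lambda>(e, w). g e w"
  have "inj_on ?G (E \<times> F)"
  proof (rule inj_onI, rule ccontr)
    fix p q assume "p \<in> E \<times> F" "q \<in> E \<times> F" "?G p = ?G q" "p \<noteq> q"
    then show False
      using apart[of "fst p" "fst q" "snd p" "snd q"] assms(1) by (auto simp: case_prod_beta)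
  qed
  then have "card (?G ` (E \<times> F)) = card E * card F"
    by (simp add: card_image card_cartesian_product)
  moreover have "separated X f (N + n) \<delta> (?G ` (E \<times> F))"
    unfolding separated_def
  proof (intro conjI ballI impI)
    show "?G ` (E \<times> F) \<subseteq> X" using g by auto
    fix x y assume "x \<in> ?G ` (E \<times> F)" "y \<in> ?G ` (E \<times> F)" "x \<noteq> y"
    then obtain e w e' w' where "e \<in> E" "w \<in> F" "e' \<in> E" "w' \<in> F" "x = g e w" "y = g e' w'"
      by auto
    with \<open>x \<noteq> y\<close> show "\<exists>i<N + n. dist ((f ^^ i) x) ((f ^^ i) y) > \<delta>"
      using apart[of e e' w w'] by auto
  qed
  ultimately show ?thesis
    using card_le_separated_number[OF assms(1)] E(1,3) F(1,3) by (metis finite_cartesian_product finite_imageI)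
qed

text \<open>
  Iterating the previous inequality gives exponential growth along the multiples of \<open>N\<close>, and a
  limit superior along a subsequence bounds the full one from below.
\<close>

lemma entropy_ge_of_ball_onto:
  assumes "X \<noteq> {}" "\<delta> > 0" "N \<ge> 1"
    and onto: "\<And>x. x \<in> X \<Longrightarrow> X \<subseteq> (f ^^ N) ` (X \<inter> cball x \<delta>)"
  shows "ereal (ln (real (separated_number X f 1 (3 * \<delta>))) / real N) \<le> topological_entropy X f"
proof -
  let ?K = "separated_number X f 1 (3 * \<delta>)"
  let ?u = "\<lambda>n. ereal (ln (real (separated_number X f n \<delta>)) / real n)"
  have K: "?K \<ge> 1" using separated_number_pos assms by simp
  have power: "?K ^ k \<le> separated_number X f (N * k) \<delta>" for k
  proof (induction k)
    case 0
    show ?case using separated_number_pos[OF assms(2,1)] by simp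
  next
    case (Suc k)
    have "?K ^ Suc k \<le> ?K * separated_number X f (N * k) \<delta>" using Suc by simp
    also have "\<dots> \<le> separated_number X f (N * Suc k) \<delta>"
      using separated_number_mult_le[OF assms(2-4)] by simp
    finally show ?case .
  qed
  have "ereal (ln (real ?K) / real N) \<le> ?u (N * k)" if "k \<ge> 1" for k
  proof -
    have "real k * ln (real ?K) = ln (real (?K ^ k))" using K by (simp add: ln_realpow)
    also have "\<dots> \<le> ln (real (separated_number X f (N * k) \<delta>))"
      using power[of k] K separated_number_pos[OF assms(2,1), of "N * k"]
      by (subst ln_le_cancel_iff) auto
    finally show ?thesis using that assms(3) by (simp add: field_simps)
  qed
  then have "\<forall>\<^sub>F k in sequentially. ereal (ln (real ?K) / real N) \<le> (?u \<circ> (\<lambda>k. N * k)) k"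
    using eventually_at_top_linorder by auto
  then have "ereal (ln (real ?K) / real N) \<le> limsup (?u \<circ> (\<lambda>k. N * k))"
    by (intro le_Limsup) auto
  also have "\<dots> \<le> limsup ?u"
    by (rule limsup_subseq_mono) (use assms(3) in \<open>auto simp: strict_mono_def\<close>)
  also have "\<dots> \<le> topological_entropy X f"
    by (rule entropy_at_scale_le_topological_entropy[OF assms(1,2)])
  finally show ?thesis .
qed

end

section \<open>Chains and mixing times\<close>

definition chain_ball_onto ::
  "'a::metric_space set \<Rightarrow> ('a \<Rightarrow> 'a) \<Rightarrow> real \<Rightarrow> real \<Rightarrow> 'a \<Rightarrow> nat \<Rightarrow> bool" where
  "chain_ball_onto X f \<epsilon> \<delta> x n \<longleftrightarrow>
     (\<forall>y\<in>X. \<exists>z \<in> X \<inter> cball x \<delta>. \<exists>p. eps_chain X f \<epsilon> n p z y)"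

lemma mixing_time_at_alt_def:
  "mixing_time_at X f \<epsilon> \<delta> x = (LEAST N. N > 0 \<and> (\<forall>n\<ge>N. chain_ball_onto X f \<epsilon> \<delta> x n))"
  by (simp add: mixing_time_at_def chain_ball_onto_def)

lemma chain_ball_onto_mono:
  assumes "chain_ball_onto X f \<epsilon> \<delta> x n" "\<epsilon> \<le> \<epsilon>'"
  shows "chain_ball_onto X f \<epsilon>' \<delta> x n"
proof -
  have "eps_chain X f \<epsilon>' n p z y" if "eps_chain X f \<epsilon> n p z y" for p z y
    using that assms(2) unfolding eps_chain_def by fastforce
  then show ?thesis using assms(1) unfolding chain_ball_onto_def by blast
qed

context
  fixes X :: "'a::metric_space set" and f :: "'a \<Rightarrow> 'a"
  assumes compact: "compact X" and cont: "continuous_on X f" and self_map: "f \<in> X \<rightarrow> X"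
begin

text \<open>
  The error of a chain is at most \<open>\<epsilon>\<close> per step, and each earlier error is distorted by the modulus
  of continuity of \<open>f\<close> a bounded number of times.
\<close>

lemma eps_chain_shadows_orbit:
  assumes "\<eta> > 0"
  obtains \<epsilon> where "\<epsilon> > 0" "\<And>p x y. eps_chain X f \<epsilon> n p x y \<Longrightarrow> dist ((f ^^ n) x) y < \<eta>"
proof -
  have "\<exists>\<epsilon>>0. \<forall>p. (\<forall>i\<le>n. p i \<in> X) \<and> (\<forall>i\<in>{1..n}. dist (f (p (i - 1))) (p i) \<le> \<epsilon>) \<longrightarrow>
      dist ((f ^^ n) (p 0)) (p n) < \<eta>"
    using assms
  proof (induction n arbitrary: \<eta>)
    case 0
    then show ?case by (auto intro: exI[of _ 1])
  next
    case (Suc n)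
    have "uniformly_continuous_on X f" using compact cont compact_uniformly_continuous by blast
    then obtain d where d: "d > 0" "\<And>x y. x \<in> X \<Longrightarrow> y \<in> X \<Longrightarrow> dist x y < d \<Longrightarrow> dist (f x) (f y) < \<eta> / 2"
      using Suc.prems unfolding uniformly_continuous_on_def by (metis dist_commute half_gt_zero)
    obtain \<epsilon> where \<epsilon>: "\<epsilon> > 0" "\<And>p. (\<forall>i\<le>n. p i \<in> X) \<Longrightarrow> (\<forall>i\<in>{1..n}. dist (f (p (i - 1))) (p i) \<le> \<epsilon>) \<Longrightarrow>
      dist ((f ^^ n) (p 0)) (p n) < d"
      using Suc.IH[OF d(1)] by blast
    show ?case
    proof (intro exI[of _ "min \<epsilon> (\<eta> / 2)"] conjI allI impI)
      show "min \<epsilon> (\<eta> / 2) > 0" using \<epsilon>(1) Suc.prems by simp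
      fix p assume p: "(\<forall>i\<le>Suc n. p i \<in> X) \<and> (\<forall>i\<in>{1..Suc n}. dist (f (p (i - 1))) (p i) \<le> min \<epsilon> (\<eta> / 2))"
      have "dist ((f ^^ n) (p 0)) (p n) < d" by (rule \<epsilon>(2)) (use p in auto)
      then have "dist (f ((f ^^ n) (p 0))) (f (p n)) < \<eta> / 2"
        using d(2) funpow_in_space[OF self_map] p by simp
      moreover have "dist (f (p n)) (p (Suc n)) \<le> \<eta> / 2"
        using p by (auto dest: bspec[of _ _ "Suc n"])
      ultimately show "dist ((f ^^ Suc n) (p 0)) (p (Suc n)) < \<eta>"
        using dist_triangle[of "f ((f ^^ n) (p 0))" "p (Suc n)" "f (p n)"] by simp
    qed
  qed
  then show ?thesis using that unfolding eps_chain_def by blast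
qed

text \<open>
  The true images of the ball come arbitrarily close to every point, and they form a compact set.
\<close>

lemma ball_onto_of_chain_ball_onto:
  assumes "\<And>\<epsilon>. \<epsilon> > 0 \<Longrightarrow> chain_ball_onto X f \<epsilon> \<delta> x N"
  shows "X \<subseteq> (f ^^ N) ` (X \<inter> cball x \<delta>)"
proof
  fix y assume y: "y \<in> X"
  let ?Y = "(f ^^ N) ` (X \<inter> cball x \<delta>)"
  have "closed ?Y"
  proof (intro compact_imp_closed compact_continuous_image)
    show "continuous_on (X \<inter> cball x \<delta>) (f ^^ N)"
      using continuous_on_funpow[OF cont self_map] continuous_on_subset by blast
    show "compact (X \<inter> cball x \<delta>)" using compact by (simp add: compact_Int_closed)
  qed
  moreover have "y \<in> closure ?Y"
    unfolding closure_approachable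
  proof (intro allI impI)
    fix \<eta> :: real assume "\<eta> > 0"
    then obtain \<epsilon> where "\<epsilon> > 0" "\<And>p x y. eps_chain X f \<epsilon> N p x y \<Longrightarrow> dist ((f ^^ N) x) y < \<eta>"
      using eps_chain_shadows_orbit by blast
    moreover from this(1) obtain z p where "z \<in> X \<inter> cball x \<delta>" "eps_chain X f \<epsilon> N p z y"
      using assms y unfolding chain_ball_onto_def by blast
    ultimately show "\<exists>w\<in>?Y. dist w y < \<eta>" by blast
  qed
  ultimately show "y \<in> ?Y" by simp
qed

end

context
  fixes X :: "'a::metric_space set" and f :: "'a \<Rightarrow> 'a"
  assumes mixing: "chain_mixing X f"
begin

text \<open>
  The length bound from chain mixing does not depend on the starting point. Hence the least element
  in the mixing time at a point exists, and the maximum over all points is over a finite set.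
\<close>

lemma chain_ball_onto_eventually:
  assumes "\<epsilon> > 0" "\<delta> \<ge> 0"
  obtains B where "B > 0" "\<And>x n. x \<in> X \<Longrightarrow> n \<ge> B \<Longrightarrow> chain_ball_onto X f \<epsilon> \<delta> x n"
proof -
  have "eps_chain_mixing X f \<epsilon>" using mixing assms(1) by (simp add: chain_mixing_def)
  then obtain B where B: "B > 0" "\<forall>x\<in>X. \<forall>y\<in>X. \<forall>n\<ge>B. \<exists>p. eps_chain X f \<epsilon> n p x y"
    unfolding eps_chain_mixing_def by (elim exE conjE)
  show ?thesis
  proof (rule that)
    fix x n assume *: "x \<in> X" "n \<ge> B"
    then have "x \<in> X \<inter> cball x \<delta>" using assms(2) by simp
    then show "chain_ball_onto X f \<epsilon> \<delta> x n"
      unfolding chain_ball_onto_def using B(2) * by meson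
  qed (fact B(1))
qed

lemma mixing_time_at_works:
  assumes "\<epsilon> > 0" "\<delta> \<ge> 0" "x \<in> X"
  shows "mixing_time_at X f \<epsilon> \<delta> x > 0 \<and> (\<forall>n\<ge>mixing_time_at X f \<epsilon> \<delta> x. chain_ball_onto X f \<epsilon> \<delta> x n)"
proof -
  obtain B where "B > 0" "\<And>x n. x \<in> X \<Longrightarrow> n \<ge> B \<Longrightarrow> chain_ball_onto X f \<epsilon> \<delta> x n"
    using chain_ball_onto_eventually[OF assms(1,2)] by blast
  then have "B > 0 \<and> (\<forall>n\<ge>B. chain_ball_onto X f \<epsilon> \<delta> x n)" using assms(3) by blast
  then show ?thesis unfolding mixing_time_at_alt_def by (rule LeastI)
qed

lemma mixing_time_at_antimono:
  assumes "0 < \<epsilon>" "\<epsilon> \<le> \<epsilon>'" "\<delta> \<ge> 0" "x \<in> X"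
  shows "mixing_time_at X f \<epsilon>' \<delta> x \<le> mixing_time_at X f \<epsilon> \<delta> x"
proof -
  note works = mixing_time_at_works[OF assms(1,3,4)]
  have "chain_ball_onto X f \<epsilon>' \<delta> x n" if "n \<ge> mixing_time_at X f \<epsilon> \<delta> x" for n
    by (rule chain_ball_onto_mono[OF _ assms(2)]) (use works that in simp)
  then show ?thesis
    unfolding mixing_time_at_alt_def[of X f \<epsilon>'] using works by (intro Least_le) simp
qed

lemma finite_mixing_times:
  assumes "\<epsilon> > 0" "\<delta> \<ge> 0"
  shows "finite (mixing_time_at X f \<epsilon> \<delta> ` X)"
proof -
  obtain B where B: "B > 0" "\<And>x n. x \<in> X \<Longrightarrow> n \<ge> B \<Longrightarrow> chain_ball_onto X f \<epsilon> \<delta> x n"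
    using chain_ball_onto_eventually[OF assms] by blast
  have "mixing_time_at X f \<epsilon> \<delta> x \<le> B" if "x \<in> X" for x
    unfolding mixing_time_at_alt_def using B that by (intro Least_le) simp
  then have "mixing_time_at X f \<epsilon> \<delta> ` X \<subseteq> {..B}" by blast
  then show ?thesis using finite_subset by blast
qed

lemma mixing_time_at_le_mixing_time:
  assumes "\<epsilon> > 0" "\<delta> \<ge> 0" "x \<in> X"
  shows "mixing_time_at X f \<epsilon> \<delta> x \<le> mixing_time X f \<epsilon> \<delta>"
  unfolding mixing_time_def using finite_mixing_times[OF assms(1,2)] assms(3) by (intro Max_ge) auto

lemma mixing_time_le_limit_mixing_time:
  assumes "X \<noteq> {}" "\<epsilon> > 0" "\<delta> \<ge> 0"
  shows "ereal (real (mixing_time X f \<epsilon> \<delta>)) \<le> limit_mixing_time X f \<delta>"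
proof -
  have "mixing_time X f t \<delta> \<le> mixing_time X f s \<delta>" if st: "0 < s" "s \<le> t" for s t
    unfolding mixing_time_def[of X f t]
  proof (intro Max.boundedI)
    show "finite (mixing_time_at X f t \<delta> ` X)" using finite_mixing_times st assms(3) by simp
    show "mixing_time_at X f t \<delta> ` X \<noteq> {}" using assms(1) by simp
    fix m assume "m \<in> mixing_time_at X f t \<delta> ` X"
    then obtain x where "x \<in> X" "m = mixing_time_at X f t \<delta> x" by blast
    then show "m \<le> mixing_time X f s \<delta>"
      using mixing_time_at_antimono[OF st assms(3)] mixing_time_at_le_mixing_time[OF st(1) assms(3)]
        order.trans by blast
  qed
  then have "limit_mixing_time X f \<delta> = (SUP \<epsilon>\<in>{0<..}. ereal (real (mixing_time X f \<epsilon> \<delta>)))"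
    unfolding limit_mixing_time_def by (intro Lim_at_right_0_eq_SUP) simp
  then show ?thesis using assms(2) by (auto intro: SUP_upper)
qed

lemma limit_mixing_time_ge_1:
  assumes "X \<noteq> {}" "\<delta> \<ge> 0"
  shows "limit_mixing_time X f \<delta> \<ge> 1"
proof -
  obtain x where "x \<in> X" using assms(1) by blast
  then have "1 \<le> mixing_time X f 1 \<delta>"
    using mixing_time_at_works[of 1 \<delta> x] mixing_time_at_le_mixing_time[of 1 \<delta> x] assms(2) by linarith
  then have "1 \<le> ereal (real (mixing_time X f 1 \<delta>))" by simp
  also have "\<dots> \<le> limit_mixing_time X f \<delta>" using mixing_time_le_limit_mixing_time assms by simp
  finally show ?thesis .
qed

text \<open>
  The integer part of the limit bounds the mixing times for all \<open>\<epsilon>\<close> at once, so chains of this one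
  length are available for every \<open>\<epsilon>\<close>; that is what lets \<open>\<epsilon>\<close> tend to \<open>0\<close> with the length fixed.
\<close>

lemma limit_mixing_time_finite_imp_ball_onto:
  assumes "compact X" "continuous_on X f" "f \<in> X \<rightarrow> X" "X \<noteq> {}" "\<delta> > 0"
    and finite_limit: "limit_mixing_time X f \<delta> = ereal r"
  defines "N \<equiv> nat \<lfloor>r\<rfloor>"
  shows "N \<ge> 1" "real N \<le> r" "\<And>x. x \<in> X \<Longrightarrow> X \<subseteq> (f ^^ N) ` (X \<inter> cball x \<delta>)"
proof -
  have "r \<ge> 1" using limit_mixing_time_ge_1[OF assms(4), of \<delta>] assms(5) finite_limit by simp
  then show "N \<ge> 1" "real N \<le> r" unfolding N_def by linarith+
  fix x assume x: "x \<in> X"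
  have "mixing_time_at X f \<epsilon> \<delta> x \<le> N" if "\<epsilon> > 0" for \<epsilon>
  proof -
    have "real (mixing_time_at X f \<epsilon> \<delta> x) \<le> r"
      using mixing_time_at_le_mixing_time[of \<epsilon> \<delta> x] mixing_time_le_limit_mixing_time[of \<epsilon> \<delta>]
        that x assms(4,5) finite_limit by force
    then show ?thesis unfolding N_def by linarith
  qed
  then show "X \<subseteq> (f ^^ N) ` (X \<inter> cball x \<delta>)"
    using mixing_time_at_works[of _ \<delta> x] x assms(5)
    by (intro ball_onto_of_chain_ball_onto[OF assms(1-3)]) simp
qed

end

section \<open>Entropy, covering numbers and dimension\<close>

lemma topological_entropy_nonneg:
  assumes "compact X" "X \<noteq> {}" "continuous_on X f" "f \<in> X \<rightarrow> X"
  shows "topological_entropy X f \<ge> 0"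
proof -
  have "separated_number X f n 1 \<ge> 1" for n
    by (rule separated_number_pos[OF assms(1,3,4)]) (use assms(2) in auto)
  then have "0 \<le> limsup (\<lambda>n. ereal (ln (real (separated_number X f n 1)) / real n))"
    by (intro le_Limsup) auto
  also have "\<dots> \<le> topological_entropy X f"
    by (rule entropy_at_scale_le_topological_entropy[OF assms(1,3,4,2)]) simp
  finally show ?thesis .
qed

lemma covering_number_pos:
  assumes "compact X" "X \<noteq> {}" "\<alpha> > 0"
  shows "covering_number X \<alpha> \<ge> 1"
proof -
  let ?P = "\<lambda>k. \<exists>C. C \<subseteq> X \<and> finite C \<and> card C = k \<and> X \<subseteq> (\<Union>c\<in>C. cball c \<alpha>)"
  obtain C where "finite C" "C \<subseteq> X" "X \<subseteq> (\<Union>c\<in>C. ball c \<alpha>)"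
    using compact_finite_ball_cover[OF assms(1,3)] by metis
  moreover from this(3) have "X \<subseteq> (\<Union>c\<in>C. cball c \<alpha>)" using ball_subset_cball by blast
  ultimately have "?P (card C)" by blast
  then have "?P (covering_number X \<alpha>)" unfolding covering_number_def by (rule LeastI)
  then show ?thesis using assms(2) by (auto simp: Suc_le_eq card_gt_0_iff)
qed

lemma lower_box_dim_nonneg:
  assumes "compact X" "X \<noteq> {}"
  shows "lower_box_dim X \<ge> 0"
  unfolding lower_box_dim_def
proof (rule Liminf_bounded)
  have "\<forall>\<^sub>F \<alpha> in at_right (0::real). 0 < \<alpha> \<and> \<alpha> < 1"
    using eventually_at_right_field[of _ 0] zero_less_one by blast
  then show "\<forall>\<^sub>F \<alpha> in at_right 0. 0 \<le> ereal (ln (real (covering_number X \<alpha>)) / ln (1 / \<alpha>))"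
    by eventually_elim (use covering_number_pos[OF assms] in \<open>force intro!: divide_nonneg_nonneg\<close>)
qed

lemma entropy_ge_covering_number_over_mixing_time:
  assumes "compact X" "X \<noteq> {}" "continuous_on X f" "f \<in> X \<rightarrow> X" "chain_mixing X f" "\<delta> > 0"
  shows "ereal (ln (real (covering_number X (3 * \<delta>)))) / limit_mixing_time X f \<delta> \<le> topological_entropy X f"
proof (cases "limit_mixing_time X f \<delta>")
  case (real r)
  note N = limit_mixing_time_finite_imp_ball_onto[OF assms(5,1,3,4,2,6) real]
  let ?K = "covering_number X (3 * \<delta>)" and ?S = "separated_number X f 1 (3 * \<delta>)"
  have "1 \<le> ?K" by (rule covering_number_pos[OF assms(1,2)]) (use assms(6) in simp)
  moreover have "?K \<le> ?S"
    using covering_number_le_separated_number[OF assms(1,3,4)] assms(6) by simp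
  ultimately have "ln (real ?K) / r \<le> ln (real ?S) / real (nat \<lfloor>r\<rfloor>)"
    using N(1,2) by (intro frac_le) auto
  then have "ereal (ln (real ?K)) / ereal r \<le> ereal (ln (real ?S) / real (nat \<lfloor>r\<rfloor>))"
    using N(1,2) by simp
  also have "\<dots> \<le> topological_entropy X f"
    by (rule entropy_ge_of_ball_onto[OF assms(1,3,4,2,6) N(1)]) (rule N(3))
  finally show ?thesis using real by simp
next
  case PInf
  then show ?thesis using topological_entropy_nonneg[OF assms(1-4)] by simp
next
  case MInf
  then show ?thesis using limit_mixing_time_ge_1[OF assms(5,2), of \<delta>] assms(6) by simp
qed

text \<open>
  Passing from scale \<open>3\<delta>\<close> to scale \<open>\<delta>\<close> costs the constant \<open>log 3\<close>, which is negligible against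
  \<open>log (1/\<delta>)\<close>: it is absorbed by an exponent \<open>b\<close> strictly between \<open>a\<close> and the dimension.
\<close>

lemma covering_number_ge_power_at_triple_scale:
  assumes "0 < a" "ereal a < lower_box_dim X"
  shows "\<forall>\<^sub>F \<delta> in at_right 0. a * ln (1 / \<delta>) \<le> ln (real (covering_number X (3 * \<delta>)))"
proof -
  obtain b where b: "a < b" "ereal b < lower_box_dim X"
    using ereal_dense2[OF assms(2)] by auto
  have "\<forall>\<^sub>F \<alpha> in at_right 0. ereal b < ereal (ln (real (covering_number X \<alpha>)) / ln (1 / \<alpha>))"
    using less_LiminfD[OF b(2)[unfolded lower_box_dim_def]] .
  moreover have "filterlim (\<lambda>\<delta>. 3 * \<delta>) (at_right 0) (at_right (0::real))"
    unfolding filterlim_at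
  proof
    show "((\<lambda>\<delta>. 3 * \<delta>) \<longlongrightarrow> 0) (at_right (0::real))"
      by (auto intro!: tendsto_eq_intros)
    have "\<forall>\<^sub>F \<delta> in at_right (0::real). 0 < \<delta>" by (simp add: eventually_at_right_less)
    then show "\<forall>\<^sub>F \<delta> in at_right (0::real). 3 * \<delta> \<in> {0<..} \<and> 3 * \<delta> \<noteq> 0"
      by eventually_elim simp
  qed
  ultimately have ev1: "\<forall>\<^sub>F \<delta> in at_right 0. ereal b <
      ereal (ln (real (covering_number X (3 * \<delta>))) / ln (1 / (3 * \<delta>)))"
    by (rule eventually_compose_filterlim)
  have "filterlim (\<lambda>\<delta>. ln (1 / \<delta>)) at_top (at_right (0::real))"
    using filterlim_compose[OF ln_at_top filterlim_inverse_at_top_right]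
    by (simp add: inverse_eq_divide)
  then have ev2: "\<forall>\<^sub>F \<delta> in at_right 0. b * ln 3 / (b - a) \<le> ln (1 / (\<delta>::real))"
    by (simp add: filterlim_at_top)
  have ev3: "\<forall>\<^sub>F \<delta> in at_right (0::real). 0 < \<delta> \<and> \<delta> < 1 / 3"
    unfolding eventually_at_right_field by (intro exI[of _ "1 / 3"]) simp
  from ev1 ev2 ev3 show ?thesis
  proof eventually_elim
    case (elim \<delta>)
    have split: "ln (1 / (3 * \<delta>)) = ln (1 / \<delta>) - ln 3"
      using elim(3) by (simp add: ln_div ln_mult)
    have "0 < ln (1 / (3 * \<delta>))" using elim(3) by (intro ln_gt_zero) (simp add: field_simps)
    then have "b * ln (1 / (3 * \<delta>)) \<le> ln (real (covering_number X (3 * \<delta>)))"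
      using elim(1) by (simp add: pos_less_divide_eq)
    moreover have "b * ln 3 \<le> (b - a) * ln (1 / \<delta>)"
      using elim(2) b(1) by (simp add: pos_divide_le_eq mult.commute)
    ultimately show ?case unfolding split by (simp add: algebra_simps)
  qed
qed

theorem theorem28:
  fixes X :: "'a::metric_space set" and f :: "'a \<Rightarrow> 'a"
  assumes "compact X"
    and "X \<noteq> {}"
    and "\<nexists>a. X = {a}"
    and "continuous_on X f"
    and "f \<in> X \<rightarrow> X"
    and "chain_mixing X f"
  shows "topological_entropy X f \<ge>
    lower_box_dim X *
      Limsup (at_right 0) (\<lambda>\<delta>. ereal (ln (1 / \<delta>)) / limit_mixing_time X f \<delta>)"
proof -
  let ?d = "lower_box_dim X" and ?h = "topological_entropy X f"
  let ?L = "Limsup (at_right 0) (\<lambda>\<delta>. ereal (ln (1 / \<delta>)) / limit_mixing_time X f \<delta>)"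
  have h: "0 \<le> ?h" using topological_entropy_nonneg assms by blast
  \<comment> \<open>Real exponents \<open>a > 0\<close> first: dividing by \<open>a\<close> is then harmless in the extended reals. The
    cases in which a factor is \<open>0\<close> or \<open>\<infinity>\<close> are settled when \<open>a\<close> tends to the dimension.\<close>
  have below_dim: "ereal a * ?L \<le> ?h" if a: "0 < a" "ereal a < ?d" for a
  proof -
    have "\<forall>\<^sub>F \<delta> in at_right (0::real). 0 < \<delta>" by (simp add: eventually_at_right_less)
    with covering_number_ge_power_at_triple_scale[OF a]
    have "\<forall>\<^sub>F \<delta> in at_right 0. ereal (ln (1 / \<delta>)) / limit_mixing_time X f \<delta> \<le> ?h / ereal a"
    proof eventually_elim
      case (elim \<delta>)
      let ?m = "limit_mixing_time X f \<delta>"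
      have "ereal a * (ereal (ln (1 / \<delta>)) / ?m) = ereal (a * ln (1 / \<delta>)) / ?m"
        by (simp add: ereal_times_divide_eq)
      also have "\<dots> \<le> ereal (ln (real (covering_number X (3 * \<delta>)))) / ?m"
      proof (rule ereal_divide_right_mono)
        have "1 \<le> ?m" using limit_mixing_time_ge_1[OF assms(6,2), of \<delta>] elim(2) by simp
        then show "0 < ?m" by (rule order.strict_trans2[rotated]) simp
      qed (use elim(1) in simp)
      also have "\<dots> \<le> ?h"
        by (rule entropy_ge_covering_number_over_mixing_time[OF assms(1,2,4-6) elim(2)])
      finally show ?case using a(1) by (simp add: ereal_le_divide_pos)
    qed
    then have "?L \<le> ?h / ereal a" by (rule Limsup_bounded)
    then show ?thesis using a(1) by (simp add: ereal_le_divide_pos)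
  qed
  consider "?d = 0" | "?L \<le> 0" | "0 < ?d" "?L = \<infinity>" | l where "0 < ?d" "?L = ereal l" "l > 0"
  proof -
    have "?d = 0 \<or> 0 < ?d"
      using lower_box_dim_nonneg[OF assms(1,2)] by (auto simp: order.order_iff_strict)
    then show ?thesis
      using that by (cases ?L) (auto simp: not_less[symmetric])
  qed
  then show ?thesis
  proof cases
    case 1
    then show ?thesis using h by simp
  next
    case 2
    then have "?d * ?L \<le> 0"
      using lower_box_dim_nonneg[OF assms(1,2)] by (simp add: ereal_mult_le_0_iff)
    then show ?thesis using h by (rule order.trans)
  next
    case 3
    obtain a where "0 < a" "ereal a < ?d" using ereal_dense2[OF 3(1)] by auto
    then have "?h = \<infinity>" using below_dim[of a] 3(2) by simp
    then show ?thesis by simp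
  next
    case 4
    have "?d \<le> ?h / ereal l"
    proof (rule dense_le_bounded[OF 4(1)])
      fix w assume w: "0 < w" "w < ?d"
      then obtain a where "w = ereal a" by (cases w) auto
      then show "w \<le> ?h / ereal l"
        using below_dim[of a] w 4(2,3) by (simp add: ereal_le_divide_pos mult.commute)
    qed
    then show ?thesis using 4(2,3) by (simp add: ereal_le_divide_pos mult.commute)
  qed
qed

end
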